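(* Let $\vartriangleright$ be an $\mathsf{S}$-consequence relation on $\mathbb{L}$, and let $\Pi,\Sigma\subseteq\mathbb{L}$. Then: (1) $C^{\mathsf{D}:\Sigma}_{\vartriangleright}$ and $C^{\mathsf{A}:\Pi}_{\vartriangleright}$ are $\mathsf{T}$-consequence operators on $\mathbb{L}$. (2) For all $\Sigma'\subseteq\mathbb{L}$, if $\Sigma\subseteq\Sigma'$ then $C^{\mathsf{D}:\Sigma}_{\vartriangleright}(\Gamma)\subseteq C^{\mathsf{D}:\Sigma'}_{\vartriangleright}(\Gamma)$ for every $\Gamma\subseteq\mathbb{L}$; and for all $\Pi'\subseteq\mathbb{L}$, if $\Pi\subseteq\Pi'$ then $C^{\mathsf{A}:\Pi}_{\vartriangleright}(\Gamma)\subseteq C^{\mathsf{A}:\Pi'}_{\vartriangleright}(\Gamma)$ for every $\Gamma\subseteq\mathbb{L}$. (3) For each $\Omega\subseteq\mathbb{L}$, either both $C^{\mathsf{D}:\overline{\Omega}}_{\vartriangleright}(\Omega)=\Omega$ and $C^{\mathsf{A}:\Omega}_{\vartriangleright}(\overline{\Omega})=\overline{\Omega}$, or else $C^{\mathsf{D}:\overline{\Omega}}_{\vartriangleright}(\Omega)=C^{\mathsf{A}:\Omega}_{\vartriangleright}(\overline{\Omega})=\mathbb{L}$. (4) $C^{\mathsf{D}:\Sigma}_{\vartriangleright}(\Pi)=\bigcap\{C^{\mathsf{D}:\overline{\Omega}}_{\vartriangleright}(\Omega):\Omega\subseteq\mathbb{L},\ \Pi\subseteq\Omega,\ \Sigma\subseteq\overline{\Omega}\}$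 and $C^{\mathsf{A}:\Pi}_{\vartriangleright}(\Sigma)=\bigcap\{C^{\mathsf{A}:\Omega}_{\vartriangleright}(\overline{\Omega}):\Omega\subseteq\mathbb{L},\ \Pi\subseteq\Omega,\ \Sigma\subseteq\overline{\Omega}\}$. (5) If $\Sigma'=C^{\mathsf{A}:\Pi}_{\vartriangleright}(\Sigma)$, then $C^{\mathsf{D}:\Sigma}_{\vartriangleright}(\Pi)=C^{\mathsf{D}:\Sigma'}_{\vartriangleright}(\Pi)$; and if $\Pi'=C^{\mathsf{D}:\Sigma}_{\vartriangleright}(\Pi)$, then $C^{\mathsf{A}:\Pi}_{\vartriangleright}(\Sigma)=C^{\mathsf{A}:\Pi'}_{\vartriangleright}(\Sigma)$. (6) If $C^{\mathsf{D}:\Sigma}_{\vartriangleright}(\Pi)\cap C^{\mathsf{A}:\Pi}_{\vartriangleright}(\Sigma)\neq\varnothing$, then $C^{\mathsf{D}:\Sigma}_{\vartriangleright}(\Pi)=C^{\mathsf{A}:\Pi}_{\vartriangleright}(\Sigma)=\mathbb{L}$.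
   Context: $\mathbb{L}$ is a fixed non-empty set (of sentences), and $\overline{\Delta}:=\mathbb{L}\setminus\Delta$ for $\Delta\subseteq\mathbb{L}$. The intersection of an empty family of subsets of $\mathbb{L}$ is $\mathbb{L}$. An $\mathsf{S}$-consequence relation on $\mathbb{L}$ is a relation $\vartriangleright$ on $\wp(\mathbb{L})\times\wp(\mathbb{L})$ such that for all $\Pi,\Pi',\Sigma,\Sigma',\Delta\subseteq\mathbb{L}$: (i) if $\Pi\vartriangleright\Sigma$ then $\Pi'\cup\Pi\vartriangleright\Sigma\cup\Sigma'$; (ii) if $\Pi\cap\Sigma\neq\varnothing$ then $\Pi\vartriangleright\Sigma$; (iii) if $\Delta'\cup\Pi\vartriangleright\Sigma\cup(\Delta\setminus\Delta')$ for every $\Delta'\subseteq\Delta$, then $\Pi\vartriangleright\Sigma$. A $\mathsf{T}$-consequence operator on $\mathbb{L}$ is a map $C:\wp(\mathbb{L})\to\wp(\mathbb{L})$ such that for all $\Gamma,\Delta\subseteq\mathbb{L}$: $C(\Gamma)\subseteq C(\Gamma\cup\Delta)$; $\Gamma\subseteq C(\Gamma)$; $C(C(\Gamma))\subseteq C(\Gamma)$. For an $\mathsf{S}$-consequence relation $\vartriangleright$ and $\Sigma,\Pi\subseteq\mathbb{L}$, define for $\Gamma\subseteq\mathbb{L}$: $C^{\mathsf{D}:\Sigma}_{\vartriangleright}(\Gamma):=\{A\in\mathbb{L}:\Gamma\vartriangleright\Sigma\cup\{A\}\}$ and $C^{\mathsf{A}:\Pi}_{\vartriangleright}(\Gamm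a):=\{A\in\mathbb{L}:\{A\}\cup\Pi\vartriangleright\Gamma\}$.
   Formalization: In the definition of a T-consequence operator, the condition C(Γ) ⊆ C(Γ ∩ Δ) is corrected to C(Γ) ⊆ C(Γ ∪ Δ); with ∩ item (1) fails, e.g. for 𝕃 = {a}, Σ = ∅ and Π ▷ Σ iff Π ∩ Σ ≠ ∅. *)

theory Defs
  imports "HOL-Library.FuncSet"
begin

definition S_consequence_relation :: "'a set \<Rightarrow> ('a set \<times> 'a set) set \<Rightarrow> bool" where
  "S_consequence_relation L R \<longleftrightarrow>
     R \<subseteq> Pow L \<times> Pow L \<and>
     (\<forall>P P' S S'. P \<subseteq> L \<longrightarrow> P' \<subseteq> L \<longrightarrow> S \<subseteq> L \<longrightarrow> S' \<subseteq> L \<longrightarrow>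
        (P, S) \<in> R \<longrightarrow> (P' \<union> P, S \<union> S') \<in> R) \<and>
     (\<forall>P S. P \<subseteq> L \<longrightarrow> S \<subseteq> L \<longrightarrow> P \<inter> S \<noteq> {} \<longrightarrow> (P, S) \<in> R) \<and>
     (\<forall>P S \<Delta>. P \<subseteq> L \<longrightarrow> S \<subseteq> L \<longrightarrow> \<Delta> \<subseteq> L \<longrightarrow>
        (\<forall>\<Delta>'. \<Delta>' \<subseteq> \<Delta> \<longrightarrow> (\<Delta>' \<union> P, S \<union> (\<Delta> - \<Delta>')) \<in> R) \<longrightarrow> (P, S) \<in> R)"

definition T_consequence_operator :: "'a set \<Rightarrow> ('a set \<Rightarrow> 'a set) \<Rightarrow> bool" where
  "T_consequence_operator L C \<longleftrightarrow>
     C \<in> Pow L \<rightarrow> Pow L \<and>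
     (\<forall>\<Gamma> \<Delta>. \<Gamma> \<subseteq> L \<longrightarrow> \<Delta> \<subseteq> L \<longrightarrow> C \<Gamma> \<subseteq> C (\<Gamma> \<union> \<Delta>)) \<and>
     (\<forall>\<Gamma>. \<Gamma> \<subseteq> L \<longrightarrow> \<Gamma> \<subseteq> C \<Gamma>) \<and>
     (\<forall>\<Gamma>. \<Gamma> \<subseteq> L \<longrightarrow> C (C \<Gamma>) \<subseteq> C \<Gamma>)"

definition C_D :: "'a set \<Rightarrow> ('a set \<times> 'a set) set \<Rightarrow> 'a set \<Rightarrow> 'a set \<Rightarrow> 'a set" where
  "C_D L R S \<Gamma> = {A \<in> L. (\<Gamma>, S \<union> {A}) \<in> R}"

definition C_A :: "'a set \<Rightarrow> ('a set \<times> 'a set) set \<Rightarrow> 'a set \<Rightarrow> 'a set \<Rightarrow> 'a set" where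
  "C_A L R P \<Gamma> = {A \<in> L. ({A} \<union> P, \<Gamma>) \<in> R}"

text \<open>Intersection of a family of subsets of \<open>L\<close>; the empty family has intersection \<open>L\<close>,
  whereas the library gives \<open>\<Inter>{} = UNIV\<close>.\<close>

definition Inter_in :: "'a set \<Rightarrow> 'a set set \<Rightarrow> 'a set" where
  "Inter_in L F = L \<inter> \<Inter>F"

end

theory Submission
  imports Defs
begin

text \<open>By cut with \<open>\<Delta> = L\<close>, an S-consequence relation is determined by the partitions
  \<open>(\<Omega>, L - \<Omega>)\<close> outside it, which act as bivaluations: \<open>(P, S)\<close> is in the relation iff no such
  \<open>\<Omega>\<close> makes everything in \<open>P\<close> true and everything in \<open>S\<close> false. In terms of these countermodels
  the deductive operator is the set of sentences true in all of them and the abductive one the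
  set of sentences false in all of them, after which every claim is elementary set theory.\<close>

text \<open>Apart from membership in \<open>R\<close>, the condition describes the interval from
  \<open>P\<close> to \<open>L - S\<close>. Hence adding a sentence to \<open>S\<close> keeps
  exactly the countermodels that omit it, and adding one to \<open>P\<close> keeps exactly those
  that contain it.\<close>

definition countermodels :: "'a set \<Rightarrow> ('a set \<times> 'a set) set \<Rightarrow> 'a set \<Rightarrow> 'a set \<Rightarrow> 'a set set"
  where "countermodels L R P S = {\<Omega>. P \<subseteq> \<Omega> \<and> \<Omega> \<subseteq> L - S \<and> (\<Omega>, L - \<Omega>) \<notin> R}"

text \<open>The conjunct \<open>A \<in> L\<close> covers the empty family, whose intersection here
  is \<open>L\<close>.\<close>

lemma mem_Inter_in_Collect:
  "A \<in> Inter_in L {f x |x. Q x} \<longleftrightarrow> A \<in> L \<and> (\<forall>x. Q x \<longrightarrow> A \<in> f x)"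
  by (auto simp: Inter_in_def)

context
  fixes L :: "'a set" and R :: "('a set \<times> 'a set) set"
  assumes R: "S_consequence_relation L R"
begin

lemma S_consequence_weaken:
  "(P, S) \<in> R \<Longrightarrow> P \<subseteq> P' \<Longrightarrow> S \<subseteq> S' \<Longrightarrow> P' \<subseteq> L \<Longrightarrow> S' \<subseteq> L \<Longrightarrow> (P', S') \<in> R"
proof -
  assume *: "(P, S) \<in> R" "P \<subseteq> P'" "S \<subseteq> S'" "P' \<subseteq> L" "S' \<subseteq> L"
  have "(P' \<union> P, S \<union> S') \<in> R"
    using R * unfolding S_consequence_relation_def by (meson order_trans)
  then show ?thesis
    using *(2,3) by (simp add: Un_absorb1 Un_absorb2)
qed

lemma S_consequence_overlap:
  "P \<subseteq> L \<Longrightarrow> S \<subseteq> L \<Longrightarrow> P \<inter> S \<noteq> {} \<Longrightarrow> (P, S) \<in> R"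
  using R unfolding S_consequence_relation_def by blast

lemma S_consequence_cut:
  "P \<subseteq> L \<Longrightarrow> S \<subseteq> L \<Longrightarrow> \<Delta> \<subseteq> L \<Longrightarrow> (\<And>\<Delta>'. \<Delta>' \<subseteq> \<Delta> \<Longrightarrow> (\<Delta>' \<union> P, S \<union> (\<Delta> - \<Delta>')) \<in> R)
    \<Longrightarrow> (P, S) \<in> R"
  using R unfolding S_consequence_relation_def by blast

text \<open>Weakening carries \<open>(P, S)\<close> to every partition in its interval. Conversely,
  cut on all of \<open>L\<close> leaves only those partitions to check, since overlap settles the
  others.\<close>

lemma S_consequence_iff_no_countermodel:
  assumes "P \<subseteq> L" "S \<subseteq> L"
  shows "(P, S) \<in> R \<longleftrightarrow> countermodels L R P S = {}"
proof
  show "countermodels L R P S = {}" if "(P, S) \<in> R"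
  proof -
    have "(\<Omega>, L - \<Omega>) \<in> R" if "P \<subseteq> \<Omega>" "\<Omega> \<subseteq> L - S" for \<Omega>
      using that assms by (intro S_consequence_weaken[OF \<open>(P, S) \<in> R\<close>]) auto
    then show ?thesis
      by (auto simp: countermodels_def)
  qed
  show "(P, S) \<in> R" if none: "countermodels L R P S = {}"
  \<comment> \<open>\<open>order_refl\<close> makes \<open>L\<close> itself the cut set, so each
    premise comes from a full partition of \<open>L\<close>.\<close>
  proof (rule S_consequence_cut[OF assms order_refl])
    fix \<Omega> assume "\<Omega> \<subseteq> L"
    show "(\<Omega> \<union> P, S \<union> (L - \<Omega>)) \<in> R"
    proof (cases "P \<subseteq> \<Omega> \<and> S \<inter> \<Omega> = {}")
      case True
      then have "(\<Omega>, L - \<Omega>) \<in> R"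
        using none \<open>\<Omega> \<subseteq> L\<close> by (auto simp: countermodels_def)
      moreover have "\<Omega> \<union> P = \<Omega>" "S \<union> (L - \<Omega>) = L - \<Omega>"
        using True assms by auto
      ultimately show ?thesis
        by simp
    next
      \<comment> \<open>Some element of \<open>P\<close> lies outside \<Omega>, or some element of
        \<open>S\<close> inside it. Either way it occurs on both sides of the pair.\<close>
      case False
      then show ?thesis
        using assms \<open>\<Omega> \<subseteq> L\<close> by (intro S_consequence_overlap) auto
    qed
  qed
qed

text \<open>\<open>(P, S \<union> {A})\<close> has as countermodels those of \<open>(P, S)\<close>
  that omit \<open>A\<close>; there are none iff \<open>A\<close> is true in all of them.\<close>

lemma C_D_eq_countermodels:
  assumes "P \<subseteq> L" "S \<subseteq> L"
  shows "C_D L R S P = {A \<in> L. \<forall>\<Omega> \<in> countermodels L R P S. A \<in> \<Omega>}"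
proof -
  have "(P, S \<union> {A}) \<in> R \<longleftrightarrow> (\<forall>\<Omega> \<in> countermodels L R P S. A \<in> \<Omega>)" if "A \<in> L" for A
  proof -
    have "(P, S \<union> {A}) \<in> R \<longleftrightarrow> countermodels L R P (S \<union> {A}) = {}"
      using assms that by (intro S_consequence_iff_no_countermodel) auto
    then show ?thesis
      by (auto simp: countermodels_def)
  qed
  then show ?thesis
    by (auto simp: C_D_def)
qed

lemma C_A_eq_countermodels:
  assumes "P \<subseteq> L" "S \<subseteq> L"
  shows "C_A L R P S = {A \<in> L. \<forall>\<Omega> \<in> countermodels L R P S. A \<notin> \<Omega>}"
proof -
  have "({A} \<union> P, S) \<in> R \<longleftrightarrow> (\<forall>\<Omega> \<in> countermodels L R P S. A \<notin> \<Omega>)" if "A \<in> L" for A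
  proof -
    have "({A} \<union> P, S) \<in> R \<longleftrightarrow> countermodels L R ({A} \<union> P) S = {}"
      using assms that by (intro S_consequence_iff_no_countermodel) auto
    then show ?thesis
      by (auto simp: countermodels_def)
  qed
  then show ?thesis
    by (auto simp: C_A_def)
qed

lemma C_D_subset: "C_D L R S P \<subseteq> L"
  by (auto simp: C_D_def)

lemma C_A_subset: "C_A L R P S \<subseteq> L"
  by (auto simp: C_A_def)

text \<open>The closure contains \<open>P\<close> and lies below every countermodel, so raising the
  lower bound to it loses none. Idempotence and the absorption laws rest on this and its
  dual.\<close>

lemma countermodels_C_D:
  assumes "P \<subseteq> L" "S \<subseteq> L"
  shows "countermodels L R (C_D L R S P) S = countermodels L R P S"
  unfolding C_D_eq_countermodels[OF assms] using assms by (auto simp: countermodels_def)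

lemma countermodels_C_A:
  assumes "P \<subseteq> L" "S \<subseteq> L"
  shows "countermodels L R P (C_A L R P S) = countermodels L R P S"
  unfolding C_A_eq_countermodels[OF assms] using assms by (auto simp: countermodels_def)

lemma countermodels_mono:
  "P \<subseteq> P' \<Longrightarrow> S \<subseteq> S' \<Longrightarrow> countermodels L R P' S' \<subseteq> countermodels L R P S"
  by (auto simp: countermodels_def)

text \<open>Fewer countermodels impose fewer conditions. Letting both sets grow covers monotonicity
  in the argument and in the index.\<close>

lemma C_D_mono:
  assumes "P \<subseteq> P'" "S \<subseteq> S'" "P' \<subseteq> L" "S' \<subseteq> L"
  shows "C_D L R S P \<subseteq> C_D L R S' P'"
proof -
  have "P \<subseteq> L" "S \<subseteq> L"
    using assms by auto
  with assms countermodels_mono[OF assms(1,2)] show ?thesis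
    by (auto simp: C_D_eq_countermodels)
qed

lemma C_A_mono:
  assumes "P \<subseteq> P'" "S \<subseteq> S'" "P' \<subseteq> L" "S' \<subseteq> L"
  shows "C_A L R P S \<subseteq> C_A L R P' S'"
proof -
  have "P \<subseteq> L" "S \<subseteq> L"
    using assms by auto
  with assms countermodels_mono[OF assms(1,2)] show ?thesis
    by (auto simp: C_A_eq_countermodels)
qed

lemma T_consequence_operator_C_D:
  assumes "S \<subseteq> L"
  shows "T_consequence_operator L (C_D L R S)"
proof -
  have "\<Gamma> \<subseteq> C_D L R S \<Gamma>" if "\<Gamma> \<subseteq> L" for \<Gamma>
    using that assms by (auto simp: C_D_eq_countermodels countermodels_def)
  moreover have "C_D L R S (C_D L R S \<Gamma>) = C_D L R S \<Gamma>" if "\<Gamma> \<subseteq> L" for \<Gamma>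
    \<comment> \<open>Only the outer closure is unfolded; its countermodels are those of \<Gamma>,
      and these describe the inner closure.\<close>
    unfolding C_D_eq_countermodels[OF C_D_subset assms] countermodels_C_D[OF that assms]
    by (rule C_D_eq_countermodels[OF that assms, symmetric])
  moreover have "C_D L R S \<Gamma> \<subseteq> C_D L R S (\<Gamma> \<union> \<Delta>)" if "\<Gamma> \<subseteq> L" "\<Delta> \<subseteq> L" for \<Gamma> \<Delta>
    using that assms by (intro C_D_mono) auto
  ultimately show ?thesis
    by (simp add: T_consequence_operator_def C_D_subset)
qed

lemma T_consequence_operator_C_A:
  assumes "P \<subseteq> L"
  shows "T_consequence_operator L (C_A L R P)"
proof -
  have "\<Gamma> \<subseteq> C_A L R P \<Gamma>" if "\<Gamma> \<subseteq> L" for \<Gamma>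
    using that assms by (auto simp: C_A_eq_countermodels countermodels_def)
  moreover have "C_A L R P (C_A L R P \<Gamma>) = C_A L R P \<Gamma>" if "\<Gamma> \<subseteq> L" for \<Gamma>
    unfolding C_A_eq_countermodels[OF assms C_A_subset] countermodels_C_A[OF assms that]
    by (rule C_A_eq_countermodels[OF assms that, symmetric])
  moreover have "C_A L R P \<Gamma> \<subseteq> C_A L R P (\<Gamma> \<union> \<Delta>)" if "\<Gamma> \<subseteq> L" "\<Delta> \<subseteq> L" for \<Gamma> \<Delta>
    using that assms by (intro C_A_mono) auto
  ultimately show ?thesis
    by (simp add: T_consequence_operator_def C_A_subset)
qed

text \<open>For a partition the interval shrinks to the single point \<Omega>.\<close>

lemma countermodels_partition:
  "\<Omega> \<subseteq> L \<Longrightarrow> countermodels L R \<Omega> (L - \<Omega>) = (if (\<Omega>, L - \<Omega>) \<in> R then {} else {\<Omega>})"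
proof -
  assume "\<Omega> \<subseteq> L"
  then have "\<Omega> \<subseteq> \<Omega>' \<and> \<Omega>' \<subseteq> L - (L - \<Omega>) \<longleftrightarrow> \<Omega>' = \<Omega>" for \<Omega>'
    by blast
  then show ?thesis
    \<comment> \<open>Regrouping the conjunction brings the two bounds together, so that the
      equivalence above can rewrite them.\<close>
    by (simp add: countermodels_def flip: conj_assoc) auto
qed

text \<open>The two cases are the dichotomy between full and fixed: no countermodel makes the
  condition vacuous, while the sole countermodel \<Omega> returns itself.\<close>

lemma C_D_partition:
  "\<Omega> \<subseteq> L \<Longrightarrow> C_D L R (L - \<Omega>) \<Omega> = (if (\<Omega>, L - \<Omega>) \<in> R then L else \<Omega>)"
  by (auto simp: C_D_eq_countermodels countermodels_partition)

lemma C_A_partition: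
  "\<Omega> \<subseteq> L \<Longrightarrow> C_A L R \<Omega> (L - \<Omega>) = (if (\<Omega>, L - \<Omega>) \<in> R then L else L - \<Omega>)"
  by (auto simp: C_A_eq_countermodels countermodels_partition)

text \<open>Partitions in \<open>R\<close> contribute \<open>L\<close> and so no constraint; the
  remaining ones are the countermodels, and each contributes itself.\<close>

lemma C_D_eq_Inter_partitions:
  assumes "P \<subseteq> L" "S \<subseteq> L"
  shows "C_D L R S P =
    Inter_in L {C_D L R (L - \<Omega>) \<Omega> |\<Omega>. \<Omega> \<subseteq> L \<and> P \<subseteq> \<Omega> \<and> S \<subseteq> L - \<Omega>}"
proof (rule set_eqI)
  fix A
  have "(\<forall>\<Omega> \<in> countermodels L R P S. A \<in> \<Omega>) \<longleftrightarrow>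
      (\<forall>\<Omega>. \<Omega> \<subseteq> L \<and> P \<subseteq> \<Omega> \<and> S \<subseteq> L - \<Omega> \<longrightarrow> A \<in> C_D L R (L - \<Omega>) \<Omega>)" if "A \<in> L"
  proof -
    have "\<Omega> \<in> countermodels L R P S \<longleftrightarrow>
        (\<Omega> \<subseteq> L \<and> P \<subseteq> \<Omega> \<and> S \<subseteq> L - \<Omega>) \<and> (\<Omega>, L - \<Omega>) \<notin> R" for \<Omega>
      using assms by (auto simp: countermodels_def)
    moreover have "A \<in> C_D L R (L - \<Omega>) \<Omega> \<longleftrightarrow> (\<Omega>, L - \<Omega>) \<in> R \<or> A \<in> \<Omega>" if "\<Omega> \<subseteq> L" for \<Omega>
      using that \<open>A \<in> L\<close> by (simp add: C_D_partition)
    ultimately show ?thesis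
      by meson
  qed
  then show "A \<in> C_D L R S P \<longleftrightarrow> A \<in> Inter_in L
      {C_D L R (L - \<Omega>) \<Omega> |\<Omega>. \<Omega> \<subseteq> L \<and> P \<subseteq> \<Omega> \<and> S \<subseteq> L - \<Omega>}"
    using C_D_eq_countermodels[OF assms] by (auto simp: mem_Inter_in_Collect)
qed

text \<open>Dually, each countermodel now contributes its complement.\<close>

lemma C_A_eq_Inter_partitions:
  assumes "P \<subseteq> L" "S \<subseteq> L"
  shows "C_A L R P S =
    Inter_in L {C_A L R \<Omega> (L - \<Omega>) |\<Omega>. \<Omega> \<subseteq> L \<and> P \<subseteq> \<Omega> \<and> S \<subseteq> L - \<Omega>}"
proof (rule set_eqI)
  fix A
  have "(\<forall>\<Omega> \<in> countermodels L R P S. A \<notin> \<Omega>) \<longleftrightarrow>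
      (\<forall>\<Omega>. \<Omega> \<subseteq> L \<and> P \<subseteq> \<Omega> \<and> S \<subseteq> L - \<Omega> \<longrightarrow> A \<in> C_A L R \<Omega> (L - \<Omega>))" if "A \<in> L"
  proof -
    have "\<Omega> \<in> countermodels L R P S \<longleftrightarrow>
        (\<Omega> \<subseteq> L \<and> P \<subseteq> \<Omega> \<and> S \<subseteq> L - \<Omega>) \<and> (\<Omega>, L - \<Omega>) \<notin> R" for \<Omega>
      using assms by (auto simp: countermodels_def)
    moreover have "A \<in> C_A L R \<Omega> (L - \<Omega>) \<longleftrightarrow> (\<Omega>, L - \<Omega>) \<in> R \<or> A \<notin> \<Omega>" if "\<Omega> \<subseteq> L" for \<Omega>
      using that \<open>A \<in> L\<close> by (simp add: C_A_partition)
    ultimately show ?thesis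
      by meson
  qed
  then show "A \<in> C_A L R P S \<longleftrightarrow> A \<in> Inter_in L
      {C_A L R \<Omega> (L - \<Omega>) |\<Omega>. \<Omega> \<subseteq> L \<and> P \<subseteq> \<Omega> \<and> S \<subseteq> L - \<Omega>}"
    using C_A_eq_countermodels[OF assms] by (auto simp: mem_Inter_in_Collect)
qed

text \<open>Adding to \<open>S\<close> what is already false in every countermodel leaves the
  countermodels, and hence the deductive closure, unchanged.\<close>

lemma C_D_absorbs_C_A:
  "P \<subseteq> L \<Longrightarrow> S \<subseteq> L \<Longrightarrow> C_D L R (C_A L R P S) P = C_D L R S P"
  by (simp add: C_D_eq_countermodels C_A_subset countermodels_C_A)

lemma C_A_absorbs_C_D:
  "P \<subseteq> L \<Longrightarrow> S \<subseteq> L \<Longrightarrow> C_A L R (C_D L R S P) S = C_A L R P S"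
  by (simp add: C_A_eq_countermodels C_D_subset countermodels_C_D)

text \<open>A common sentence would be both true and false in any countermodel. So there is none,
  and both closures are vacuously \<open>L\<close>.\<close>

lemma C_D_C_A_overlap:
  assumes "P \<subseteq> L" "S \<subseteq> L" "C_D L R S P \<inter> C_A L R P S \<noteq> {}"
  shows "C_D L R S P = L \<and> C_A L R P S = L"
proof -
  have "countermodels L R P S = {}"
    using assms by (auto simp: C_D_eq_countermodels C_A_eq_countermodels)
  then show ?thesis
    using assms by (simp add: C_D_eq_countermodels C_A_eq_countermodels)
qed

end

theorem proposition3p1:
  fixes L :: "'a set" and R :: "('a set \<times> 'a set) set" and P S :: "'a set"
  assumes "L \<noteq> {}"
    and "S_consequence_relation L R"
    and "P \<subseteq> L" and "S \<subseteq> L"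
  shows
    "(T_consequence_operator L (C_D L R S) \<and> T_consequence_operator L (C_A L R P)) \<and>
     ((\<forall>S'. S' \<subseteq> L \<longrightarrow> S \<subseteq> S' \<longrightarrow> (\<forall>\<Gamma>. \<Gamma> \<subseteq> L \<longrightarrow> C_D L R S \<Gamma> \<subseteq> C_D L R S' \<Gamma>)) \<and>
      (\<forall>P'. P' \<subseteq> L \<longrightarrow> P \<subseteq> P' \<longrightarrow> (\<forall>\<Gamma>. \<Gamma> \<subseteq> L \<longrightarrow> C_A L R P \<Gamma> \<subseteq> C_A L R P' \<Gamma>))) \<and>
     (\<forall>\<Omega>. \<Omega> \<subseteq> L \<longrightarrow>
        (let both_fixed = (C_D L R (L - \<Omega>) \<Omega> = \<Omega> \<and> C_A L R \<Omega> (L - \<Omega>) = L - \<Omega>);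
             both_full = (C_D L R (L - \<Omega>) \<Omega> = L \<and> C_A L R \<Omega> (L - \<Omega>) = L)
         in (both_fixed \<or> both_full) \<and> \<not> (both_fixed \<and> both_full))) \<and>
     (C_D L R S P =
        Inter_in L {C_D L R (L - \<Omega>) \<Omega> |\<Omega>. \<Omega> \<subseteq> L \<and> P \<subseteq> \<Omega> \<and> S \<subseteq> L - \<Omega>} \<and>
      C_A L R P S =
        Inter_in L {C_A L R \<Omega> (L - \<Omega>) |\<Omega>. \<Omega> \<subseteq> L \<and> P \<subseteq> \<Omega> \<and> S \<subseteq> L - \<Omega>}) \<and>
     ((\<forall>S'. S' = C_A L R P S \<longrightarrow> C_D L R S P = C_D L R S' P) \<and>
      (\<forall>P'. P' = C_D L R S P \<longrightarrow> C_A L R P S = C_A L R P' S)) \<and>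
     (C_D L R S P \<inter> C_A L R P S \<noteq> {} \<longrightarrow> C_D L R S P = L \<and> C_A L R P S = L)"
proof (intro conjI allI impI)
  note [simp] = assms
  show "T_consequence_operator L (C_D L R S)"
    by (simp add: T_consequence_operator_C_D)
  show "T_consequence_operator L (C_A L R P)"
    by (simp add: T_consequence_operator_C_A)
  show "C_D L R S \<Gamma> \<subseteq> C_D L R S' \<Gamma>" if "S' \<subseteq> L" "S \<subseteq> S'" "\<Gamma> \<subseteq> L" for S' \<Gamma>
    using that by (simp add: C_D_mono)
  show "C_A L R P \<Gamma> \<subseteq> C_A L R P' \<Gamma>" if "P' \<subseteq> L" "P \<subseteq> P'" "\<Gamma> \<subseteq> L" for P' \<Gamma>
    using that by (simp add: C_A_mono)
  \<comment> \<open>The alternatives exclude each other because together they would give \<Omega>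
    and its complement both equal to \<open>L\<close>, forcing \<open>L\<close> to be empty.\<close>
  show "let both_fixed = (C_D L R (L - \<Omega>) \<Omega> = \<Omega> \<and> C_A L R \<Omega> (L - \<Omega>) = L - \<Omega>);
            both_full = (C_D L R (L - \<Omega>) \<Omega> = L \<and> C_A L R \<Omega> (L - \<Omega>) = L)
        in (both_fixed \<or> both_full) \<and> \<not> (both_fixed \<and> both_full)" if "\<Omega> \<subseteq> L" for \<Omega>
    using that \<open>L \<noteq> {}\<close>
    by (auto simp: Let_def C_D_partition[OF assms(2)] C_A_partition[OF assms(2)])
  show "C_D L R S P = Inter_in L {C_D L R (L - \<Omega>) \<Omega> |\<Omega>. \<Omega> \<subseteq> L \<and> P \<subseteq> \<Omega> \<and> S \<subseteq> L - \<Omega>}"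
    by (rule C_D_eq_Inter_partitions) simp_all
  show "C_A L R P S = Inter_in L {C_A L R \<Omega> (L - \<Omega>) |\<Omega>. \<Omega> \<subseteq> L \<and> P \<subseteq> \<Omega> \<and> S \<subseteq> L - \<Omega>}"
    by (rule C_A_eq_Inter_partitions) simp_all
  show "C_D L R S P = C_D L R S' P" if "S' = C_A L R P S" for S'
    by (simp add: that C_D_absorbs_C_A)
  show "C_A L R P S = C_A L R P' S" if "P' = C_D L R S P" for P'
    by (simp add: that C_A_absorbs_C_D)
  show "C_D L R S P = L" "C_A L R P S = L" if "C_D L R S P \<inter> C_A L R P S \<noteq> {}"
    using C_D_C_A_overlap[OF assms(2-4) that] by simp_all
qed

end
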